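(* Let $p>2$. There exists a constant $c_p>0$ depending only on $p$ such that the following holds. Let $s>0$, $L>0$, let $N\ge1$ be an integer, and let $v\in\mathbb{R}^d$ be a unit vector. Then there is a choice of $r>0$ such that, for the problem instance $$f(x)=\tfrac12x^\top Ax-b^\top x+\tfrac sp\|x\|^p,\qquad A=L(I-vv^\top),\quad b=s r^{p-1}v$$ (whose unique minimizer is $x_\star=rv$), every one-step method started at $x_0=0$ whose iterates on this instance, written $x_k=r_kv$, satisfy $$r_k\le r\quad\text{and}\quad r-r_{k+1}\ge (r-r_k)\bigl(1-\bar Q^{-1}\bigr)\quad\text{for all }k\ge0,\qquad \bar Q:=\frac{L+s(p-1)r^{p-2}}{s(p-1)r^{p-2}},$$ has $$f(x_N)-f_\star\ \ge\ c_p\Bigl[\frac{L}{s^{2/p}N}\Bigr]^{\frac{p}{p-2}}\qquad\text{and}\qquad \|\nabla f(x_N)\|\ \ge\ c_p\Bigl[\frac{L}{s^{1/(p-1)}N}\Bigr]^{\frac{p-1}{p-2}},$$ where $f_\star=f(x_\star)$.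
   Context: A one-step method produces iterates $x_{k+1}=\alpha_kx_k-\beta_k\nabla q(x_k)$, $k\ge0$, $x_0=0$, where $q(x)=\frac12x^\top Ax-b^\top x$ is the quadratic part of $f$ and $\alpha_k,\beta_k>0$ are some parameters. On the instance above all iterates lie on the line spanned by $v$, so $x_k=r_kv$ with $r_k\in\mathbb{R}$, $r_0=0$. $\|\cdot\|$ is the Euclidean norm. *)

theory Defs
  imports "HOL-Analysis.Derivative" "Jordan_Normal_Form.Matrix"
begin

text \<open>
  Vectors of \<open>\<real>\<^sup>d\<close> are elements of \<^term>\<open>carrier_vec d :: real vec set\<close>, so that the dimension is
  an ordinary number and a constant can be chosen before it. (With a type-indexed dimension, a
  constant that is existentially quantified in a theorem could depend on the dimension.)
\<close>

definition euclid_norm :: "real vec \<Rightarrow> real" where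
  "euclid_norm x = sqrt (scalar_prod x x)"

text \<open>
  The vector of partial derivatives. All functions it is applied to below are continuously
  differentiable (the exponent of the norm is greater than 2), so the value is the gradient
  everywhere, including at the origin.
\<close>

definition gradient :: "nat \<Rightarrow> (real vec \<Rightarrow> real) \<Rightarrow> real vec \<Rightarrow> real vec" where
  "gradient d f x = vec d (\<lambda>i. deriv (\<lambda>t. f (x + t \<cdot>\<^sub>v unit_vec d i)) 0)"

definition quad :: "real mat \<Rightarrow> real vec \<Rightarrow> real vec \<Rightarrow> real" where
  "quad A b x = 1 / 2 * scalar_prod x (A *\<^sub>v x) - scalar_prod b x"

definition objective :: "real mat \<Rightarrow> real vec \<Rightarrow> real \<Rightarrow> real \<Rightarrow> real vec \<Rightarrow> real" where
  "objective A b s p x = quad A b x + s / p * euclid_norm x powr p"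

definition outer_prod :: "real vec \<Rightarrow> real vec \<Rightarrow> real mat" where
  "outer_prod u v = mat (dim_vec u) (dim_vec v) (\<lambda>(i, j). vec_index u i * vec_index v j)"

text \<open>
  The iterates of a one-step method started at the origin. The parameters are arbitrary positive
  sequences, so they may depend on the instance and on earlier iterates.
\<close>

definition one_step_method ::
  "nat \<Rightarrow> real mat \<Rightarrow> real vec \<Rightarrow> (nat \<Rightarrow> real) \<Rightarrow> (nat \<Rightarrow> real) \<Rightarrow> (nat \<Rightarrow> real vec) \<Rightarrow> bool" where
  "one_step_method d A b \<alpha> \<beta> x \<longleftrightarrow>
     (\<forall>k. \<alpha> k > 0 \<and> \<beta> k > 0) \<and> x 0 = 0\<^sub>v d \<and>
     (\<forall>k. x (Suc k) = \<alpha> k \<cdot>\<^sub>v x k - \<beta> k \<cdot>\<^sub>v gradient d (quad A b) (x k))"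

end

theory Submission
  imports Defs
begin

text \<open>
  On the line spanned by \<open>v\<close> the quadratic term vanishes and the objective is
  \<open>s (\<bar>\<rho>\<bar>\<^sup>p / p - r\<^sup>p\<^sup>-\<^sup>1 \<rho>)\<close>. The radius \<open>r\<close> is chosen such that
  \<open>s (p - 1) r\<^sup>p\<^sup>-\<^sup>2 = L / (2 N)\<close>, so that the inverse of \<open>Q\<close> is \<open>1 / (2 N + 1)\<close> and, by Bernoulli's
  inequality, \<open>N\<close> steps close at most half of the gap \<open>r\<close>. At a point \<open>\<rho> \<le> r / 2\<close>, strict
  convexity bounds the objective gap below by a multiple of \<open>s r\<^sup>p\<close> and the gradient norm by a
  multiple of \<open>s r\<^sup>p\<^sup>-\<^sup>1\<close>; inserting \<open>r\<close> gives the rates.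
\<close>

section \<open>Strict convexity of powers on the real line\<close>

text \<open>On the half-line of nonnegative reals, the power minus its tangent slope times the
  variable has derivative \<open>p * (x powr (p - 1) - a powr (p - 1))\<close>, which changes sign
  exactly at \<open>a\<close>. A negative \<open>y\<close> is replaced by
  \<open>\<bar>y\<bar>\<close>, which can only raise the linear term because the slope is
  positive.\<close>

lemma powr_gt_tangent:
  fixes p a y :: real
  assumes "p > 1" "a > 0" "y \<noteq> a"
  shows "\<bar>y\<bar> powr p > a powr p + p * a powr (p - 1) * (y - a)"
proof -
  define h where "h = (\<lambda>y::real. y powr p - p * a powr (p - 1) * y)"
  have der: "(h has_real_derivative p * (x powr (p - 1) - a powr (p - 1))) (at x)" if "x > 0" for x
    unfolding h_def using that by (auto intro!: derivative_eq_intros simp: algebra_simps)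
  \<comment> \<open>The left endpoint may be 0, which \<open>der\<close> does not cover; the
    monotonicity rules below ask for derivatives on the open interval only.\<close>
  have cont: "continuous_on {u..w} h" if "u \<ge> 0" for u w
    unfolding h_def using that assms
    by (intro continuous_on_diff continuous_on_powr' continuous_intros) auto
  have gt: "h z > h a" if "z \<ge> 0" "z \<noteq> a" for z
  proof (cases "z < a")
    case True
    then show ?thesis
    proof (rule DERIV_neg_imp_decreasing_open)
      fix x assume x: "z < x" "x < a"
      then have "x powr (p - 1) < a powr (p - 1)"
        using assms that by (intro powr_less_mono2) auto
      then have "p * (x powr (p - 1) - a powr (p - 1)) < 0"
        using assms by (simp add: mult_less_0_iff)
      then show "\<exists>D. DERIV h x :> D \<and> D < 0"
        using der[of x] x that by auto
    qed (use cont that in auto)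
  next
    case False
    then have "a < z" using that by simp
    then show ?thesis
    proof (rule DERIV_pos_imp_increasing_open)
      fix x assume x: "a < x" "x < z"
      then have "x powr (p - 1) > a powr (p - 1)"
        using assms that by (intro powr_less_mono2) auto
      then have "p * (x powr (p - 1) - a powr (p - 1)) > 0"
        using assms by simp
      then show "\<exists>D. DERIV h x :> D \<and> D > 0"
        using der[of x] x assms by auto
    qed (use cont assms in auto)
  qed
  show ?thesis
  proof (cases "\<bar>y\<bar> = a")
    case True
    then have "y - a < 0" using assms by auto
    then have "p * a powr (p - 1) * (y - a) < 0"
      using assms by (intro mult_pos_neg) auto
    then show ?thesis using True by simp
  next
    case False
    then have "h \<bar>y\<bar> > h a" by (intro gt) auto
    moreover have "p * a powr (p - 1) * y \<le> p * a powr (p - 1) * \<bar>y\<bar>"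
      using assms by (intro mult_left_mono) auto
    ultimately show ?thesis by (simp add: h_def algebra_simps)
  qed
qed

lemma powr_mult_self_pred:
  fixes a p :: real
  assumes "a > 0"
  shows "a * a powr (p - 1) = a powr p"
  using assms by (simp add: powr_mult_base)

text \<open>The tangent inequality at \<open>r\<close>, divided by \<open>p\<close>. The left-hand
  side is the objective on the line divided by \<open>s\<close>, so this is strict minimality of
  \<open>r\<close> there.\<close>

lemma power_young_strict:
  fixes p r y :: real
  assumes "p > 1" "r > 0" "y \<noteq> r"
  shows "\<bar>y\<bar> powr p / p - r powr (p - 1) * y > r powr p / p - r powr p"
proof -
  have "p * (\<bar>y\<bar> powr p / p - r powr (p - 1) * y) > p * (r powr p / p - r powr p)"
    using powr_gt_tangent[OF assms] powr_mult_self_pred[of r p] assms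
    by (simp add: algebra_simps)
  then show ?thesis using assms by (simp only: mult_less_cancel_left_pos)
qed

text \<open>The tangent is taken at \<open>r / 2\<close> instead of \<open>r\<close>. There the
  function on the left has slope \<open>a powr (p - 1) - r powr (p - 1) \<le> 0\<close>, so its
  value at any \<open>y \<le> r / 2\<close> is at least its value at \<open>r / 2\<close>; the
  factor on the right is the gap at that point.\<close>

lemma power_gap_lower_bound:
  fixes p r y :: real
  assumes "p > 1" "r > 0" "y \<le> r / 2"
  shows "(\<bar>y\<bar> powr p / p - r powr (p - 1) * y) - (r powr p / p - r powr p)
      \<ge> ((1/2) powr p / p + 1/2 - 1/p) * r powr p"
proof -
  define a where "a = r / 2"
  have a: "a > 0" "r = 2 * a" using assms by (auto simp: a_def)
  have "\<bar>y\<bar> powr p \<ge> a powr p + p * a powr (p - 1) * (y - a)"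
  proof (cases "y = a")
    case False then show ?thesis using powr_gt_tangent[OF assms(1) a(1) False] by simp
  qed (use a in auto)
  then have "\<bar>y\<bar> powr p / p \<ge> (a powr p + p * a powr (p - 1) * (y - a)) / p"
    using assms by (intro divide_right_mono) auto
  then have 1: "\<bar>y\<bar> powr p / p \<ge> a powr p / p + a powr (p - 1) * (y - a)"
    using assms by (simp add: add_divide_distrib)
  have "a powr (p - 1) \<le> r powr (p - 1)"
    using a assms by (intro powr_mono2) auto
  then have "(r powr (p - 1) - a powr (p - 1)) * (a - y) \<ge> 0"
    using assms by (intro mult_nonneg_nonneg) (auto simp: a_def)
  then have "\<bar>y\<bar> powr p / p - r powr (p - 1) * y \<ge> a powr p / p - r powr (p - 1) * a"
    using 1 by (simp add: algebra_simps)
  moreover have "a powr p = (1/2) powr p * r powr p"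
    using assms by (simp add: a_def powr_divide)
  moreover have "r powr (p - 1) * a = r powr p / 2"
    using powr_mult_self_pred[of r p] assms by (simp add: a_def mult.commute)
  ultimately show ?thesis by (simp add: field_simps)
qed

section \<open>Decay of the gap along the iterates\<close>

text \<open>Iterating the recursion gives the factor \<open>(1 - q) ^ k\<close>, where
  \<open>q \<le> 1\<close> keeps the direction of the inequality; Bernoulli's inequality makes it
  linear in \<open>k\<close>.\<close>

lemma geometric_gap:
  fixes r q :: real and \<rho> :: "nat \<Rightarrow> real"
  assumes "\<rho> 0 = 0" "0 \<le> r" "0 \<le> q" "q \<le> 1"
    and step: "\<And>k. r - \<rho> (Suc k) \<ge> (r - \<rho> k) * (1 - q)"
  shows "r - \<rho> k \<ge> r * (1 - real k * q)"
proof -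
  have "r - \<rho> k \<ge> r * (1 - q) ^ k"
  proof (induction k)
    case (Suc k)
    have "r * (1 - q) ^ Suc k = r * (1 - q) ^ k * (1 - q)" by simp
    also have "\<dots> \<le> (r - \<rho> k) * (1 - q)" using Suc assms by (intro mult_right_mono) auto
    finally show ?case using step[of k] by linarith
  qed (use assms in simp)
  moreover have "r * (1 - real k * q) \<le> r * (1 - q) ^ k"
    using Bernoulli_inequality[of "- q" k] assms by (intro mult_left_mono) auto
  ultimately show ?thesis by linarith
qed

section \<open>Euclidean geometry relative to a unit vector\<close>

lemma euclid_norm_square:
  "euclid_norm x ^ 2 = scalar_prod x x"
proof -
  have "scalar_prod x x \<ge> 0" by (simp add: scalar_prod_def sum_nonneg)
  then show ?thesis by (simp add: euclid_norm_def)
qed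

lemma euclid_norm_smult:
  "euclid_norm (a \<cdot>\<^sub>v x) = \<bar>a\<bar> * euclid_norm x"
proof -
  have "scalar_prod (a \<cdot>\<^sub>v x) (a \<cdot>\<^sub>v x) = a\<^sup>2 * scalar_prod x x"
    by (simp add: scalar_prod_def sum_distrib_left power2_eq_square algebra_simps)
  then show ?thesis by (simp add: euclid_norm_def real_sqrt_mult)
qed

lemma scalar_prod_self_eq_0:
  fixes x :: "real vec"
  assumes "x \<in> carrier_vec d" "scalar_prod x x = 0"
  shows "x = 0\<^sub>v d"
proof (rule eq_vecI)
  have "\<forall>i\<in>{0..<dim_vec x}. x $ i * x $ i = 0"
    using assms(2) unfolding scalar_prod_def
    by (subst (asm) sum_nonneg_eq_0_iff) auto
  then show "x $ i = 0\<^sub>v d $ i" if "i < dim_vec (0\<^sub>v d)" for i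
    using that assms(1) by auto
qed (use assms in auto)

text \<open>Serves two purposes: with \<open>a = scalar_prod v x\<close> it gives the Cauchy-Schwarz
  inequality, and with \<open>a = r\<close> it measures the distance to the minimizer.\<close>

lemma scalar_prod_diff_smult_unit:
  fixes x v :: "real vec"
  assumes "x \<in> carrier_vec d" "v \<in> carrier_vec d" "scalar_prod v v = 1"
  shows "scalar_prod (x - a \<cdot>\<^sub>v v) (x - a \<cdot>\<^sub>v v) = scalar_prod x x - 2 * a * scalar_prod v x + a\<^sup>2"
proof -
  have "scalar_prod (x - a \<cdot>\<^sub>v v) (x - a \<cdot>\<^sub>v v)
      = (\<Sum>i<d. (x $ i - a * v $ i) * (x $ i - a * v $ i))"
    using assms by (simp add: scalar_prod_def lessThan_atLeast0)
  also have "\<dots> = (\<Sum>i<d. x $ i * x $ i) - 2 * a * (\<Sum>i<d. v $ i * x $ i) + a\<^sup>2 * (\<Sum>i<d. v $ i * v $ i)"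
    by (simp add: sum_distrib_left sum_subtractf[symmetric] sum.distrib[symmetric] power2_eq_square algebra_simps)
  also have "\<dots> = scalar_prod x x - 2 * a * scalar_prod v x + a\<^sup>2 * scalar_prod v v"
    using assms by (simp add: scalar_prod_def lessThan_atLeast0)
  finally show ?thesis using assms(3) by simp
qed

text \<open>The component of \<open>x\<close> orthogonal to \<open>v\<close> has nonnegative squared
  length.\<close>

lemma square_scalar_prod_unit_le:
  fixes x v :: "real vec"
  assumes "x \<in> carrier_vec d" "v \<in> carrier_vec d" "scalar_prod v v = 1"
  shows "(scalar_prod v x)\<^sup>2 \<le> scalar_prod x x"
proof -
  have "0 \<le> scalar_prod (x - scalar_prod v x \<cdot>\<^sub>v v) (x - scalar_prod v x \<cdot>\<^sub>v v)"
    by (auto simp: scalar_prod_def intro: sum_nonneg)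
  then show ?thesis
    unfolding scalar_prod_diff_smult_unit[OF assms] by (simp add: power2_eq_square)
qed

section \<open>Values and gradients of the objective on the line\<close>

text \<open>The outer product sends \<open>x\<close> to \<open>scalar_prod v x\<close> times
  \<open>v\<close>, hence \<open>A x = L (x - (v . x) v)\<close>. Afterwards only the two scalar
  products \<open>x . x\<close> and \<open>v . x\<close> matter.\<close>

lemma quad_complement_projection:
  fixes x v :: "real vec"
  assumes "x \<in> carrier_vec d" "v \<in> carrier_vec d"
  shows "quad (L \<cdot>\<^sub>m (1\<^sub>m d - outer_prod v v)) (\<beta> \<cdot>\<^sub>v v) x
     = L / 2 * (scalar_prod x x - (scalar_prod v x)\<^sup>2) - \<beta> * scalar_prod v x"
proof -
  let ?A = "L \<cdot>\<^sub>m (1\<^sub>m d - outer_prod v v)"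
  have Ax: "(?A *\<^sub>v x) $ i = L * (x $ i - v $ i * scalar_prod v x)" if "i < d" for i
  proof -
    have "(?A *\<^sub>v x) $ i = (\<Sum>j<d. L * ((if i = j then 1 else 0) - v $ i * v $ j) * x $ j)"
      using that assms
      by (auto simp: outer_prod_def scalar_prod_def lessThan_atLeast0 intro!: sum.cong)
    also have "\<dots> = (\<Sum>j<d. (if i = j then L * x $ j else 0) - L * v $ i * (v $ j * x $ j))"
      by (rule sum.cong) (auto simp: algebra_simps)
    also have "\<dots> = L * x $ i - L * v $ i * (\<Sum>j<d. v $ j * x $ j)"
      using that by (simp add: sum_subtractf sum_distrib_left)
    finally show ?thesis
      using assms by (simp add: scalar_prod_def lessThan_atLeast0 algebra_simps)
  qed
  have "scalar_prod x (?A *\<^sub>v x) = (\<Sum>i<d. x $ i * (L * (x $ i - v $ i * scalar_prod v x)))"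
    unfolding scalar_prod_def[of x "?A *\<^sub>v x"]
    using Ax assms by (intro sum.cong) (auto simp: outer_prod_def)
  also have "\<dots> = L * (\<Sum>i<d. x $ i * x $ i) - L * scalar_prod v x * (\<Sum>i<d. v $ i * x $ i)"
    by (simp add: sum_distrib_left sum_subtractf[symmetric] algebra_simps)
  also have "\<dots> = L * (scalar_prod x x - (scalar_prod v x)\<^sup>2)"
    using assms by (simp add: scalar_prod_def lessThan_atLeast0 power2_eq_square algebra_simps)
  finally show ?thesis using assms by (simp add: quad_def)
qed

text \<open>The gradient is defined by coordinate derivatives, so the objective must be evaluated at
  points pushed off the line in a coordinate direction; both scalar products it depends on become
  polynomials in \<open>t\<close>.\<close>

lemma scalar_prods_on_line_perturbed:
  fixes v :: "real vec" and \<rho> t :: real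
  assumes "v \<in> carrier_vec d" "scalar_prod v v = 1" "i < d"
  defines "y \<equiv> \<lambda>t. \<rho> \<cdot>\<^sub>v v + t \<cdot>\<^sub>v unit_vec d i"
  shows "scalar_prod v (y t) = \<rho> + t * v $ i"
    and "scalar_prod (y t) (y t) = \<rho>\<^sup>2 + 2 * \<rho> * t * v $ i + t\<^sup>2"
proof -
  show 1: "scalar_prod v (y t) = \<rho> + t * v $ i"
    using assms by (simp add: scalar_prod_add_distrib[of _ d])
  have "scalar_prod (unit_vec d i) (y t) = \<rho> * v $ i + t"
    using assms by (simp add: scalar_prod_add_distrib[of _ d])
  moreover have "scalar_prod (y t) (y t) = \<rho> * scalar_prod v (y t) + t * scalar_prod (unit_vec d i) (y t)"
    using assms by (simp add: add_scalar_prod_distrib[of _ d])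
  ultimately show "scalar_prod (y t) (y t) = \<rho>\<^sup>2 + 2 * \<rho> * t * v $ i + t\<^sup>2"
    by (simp add: 1 power2_eq_square algebra_simps)
qed

text \<open>The difference quotient has modulus \<open>\<bar>h\<bar> powr (p - 1)\<close>, which
  tends to 0. This settles the origin, where the chain rule for \<open>powr\<close> needs a positive
  base.\<close>

lemma abs_powr_has_derivative_at_0:
  fixes p :: real
  assumes "p > 1"
  shows "((\<lambda>t. \<bar>t\<bar> powr p) has_real_derivative 0) (at 0)"
proof -
  have "((\<lambda>h. \<bar>h\<bar> powr (p - 1)) \<longlongrightarrow> \<bar>0\<bar> powr (p - 1)) (at (0::real))"
    using assms by (intro tendsto_intros) auto
  then have "((\<lambda>h. \<bar>h\<bar> powr (p - 1)) \<longlongrightarrow> 0) (at (0::real))" by simp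
  moreover have "\<bar>\<bar>h\<bar> powr p / h\<bar> = \<bar>h\<bar> powr (p - 1)" if "h \<noteq> 0" for h :: real
    using that powr_mult_self_pred[of "\<bar>h\<bar>" p] by (simp add: field_simps)
  then have "\<forall>\<^sub>F h in at (0::real). \<bar>h\<bar> powr (p - 1) = \<bar>\<bar>h\<bar> powr p / h\<bar>"
    by (auto simp: eventually_at intro!: exI[of _ 1])
  ultimately have "((\<lambda>h. \<bar>\<bar>h\<bar> powr p / h\<bar>) \<longlongrightarrow> 0) (at (0::real))"
    by (rule Lim_transform_eventually)
  then have "((\<lambda>h. \<bar>h\<bar> powr p / h) \<longlongrightarrow> 0) (at (0::real))"
    using tendsto_rabs_zero_iff by blast
  then show ?thesis by (simp add: DERIV_def)
qed

lemma sqrt_powr: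
  fixes u p :: real
  assumes "u \<ge> 0"
  shows "sqrt u powr p = u powr (p / 2)"
proof -
  have "sqrt u powr p = (u powr (1/2)) powr p" using assms by (simp only: powr_half_sqrt)
  then show ?thesis by (simp add: powr_powr)
qed

text \<open>The norm is the square root of the quadratic polynomial \<open>g\<close>. For
  \<open>\<rho> \<noteq> 0\<close> the value \<open>g 0\<close> is positive and the chain rule
  applies to \<open>g t powr (p / 2)\<close>; for \<open>\<rho> = 0\<close> the function is
  \<open>\<bar>t\<bar> powr p\<close>. The \<open>sgn\<close> form covers both cases.\<close>

lemma norm_powr_partial_derivative:
  fixes v :: "real vec"
  assumes "p > 2" "v \<in> carrier_vec d" "scalar_prod v v = 1" "i < d"
  shows "((\<lambda>t. euclid_norm (\<rho> \<cdot>\<^sub>v v + t \<cdot>\<^sub>v unit_vec d i) powr p)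
           has_real_derivative p * (sgn \<rho> * \<bar>\<rho>\<bar> powr (p - 1)) * v $ i) (at 0)"
proof -
  define g where "g t = \<rho>\<^sup>2 + 2 * \<rho> * t * v $ i + t\<^sup>2" for t
  have norm: "euclid_norm (\<rho> \<cdot>\<^sub>v v + t \<cdot>\<^sub>v unit_vec d i) = sqrt (g t)" for t
    using scalar_prods_on_line_perturbed(2)[OF assms(2-4)] by (simp add: euclid_norm_def g_def)
  \<comment> \<open>Needed for all \<open>t\<close> to rewrite the power of the square root; it is
    immediate because \<open>g t\<close> is a squared norm.\<close>
  have g_nonneg: "g t \<ge> 0" for t
  proof -
    have "scalar_prod (\<rho> \<cdot>\<^sub>v v + t \<cdot>\<^sub>v unit_vec d i) (\<rho> \<cdot>\<^sub>v v + t \<cdot>\<^sub>v unit_vec d i) \<ge> 0"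
      by (simp add: scalar_prod_def sum_nonneg)
    then show ?thesis
      using scalar_prods_on_line_perturbed(2)[OF assms(2-4)] by (simp add: g_def)
  qed
  show ?thesis
  proof (cases "\<rho> = 0")
    case True
    then show ?thesis
      using abs_powr_has_derivative_at_0[of p] assms unfolding norm by (simp add: g_def)
  next
    case False
    have gd: "(g has_real_derivative 2 * \<rho> * v $ i) (at 0)"
      unfolding g_def by (auto intro!: derivative_eq_intros)
    have der: "((\<lambda>t. g t powr (p / 2)) has_real_derivative p / 2 * g 0 powr (p / 2 - 1) * (2 * \<rho> * v $ i)) (at 0)"
      using DERIV_fun_powr[OF gd, of "p / 2"] False by (simp add: g_def)
    have g0: "g 0 powr (p / 2 - 1) = \<bar>\<rho>\<bar> powr (p - 2)"
    proof -
      have "g 0 powr (p / 2 - 1) = (\<bar>\<rho>\<bar> powr 2) powr (p / 2 - 1)"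
        using False by (simp add: g_def powr_numeral)
      also have "\<dots> = \<bar>\<rho>\<bar> powr (p - 2)"
        unfolding powr_powr by (simp add: algebra_simps)
      finally show ?thesis .
    qed
    have sgn: "\<bar>\<rho>\<bar> powr (p - 2) * \<rho> = sgn \<rho> * \<bar>\<rho>\<bar> powr (p - 1)"
      using powr_mult_self_pred[of "\<bar>\<rho>\<bar>" "p - 1"] False
      by (auto simp: sgn_if algebra_simps abs_if split: if_splits)
    have "p / 2 * g 0 powr (p / 2 - 1) * (2 * \<rho> * v $ i) = p * (sgn \<rho> * \<bar>\<rho>\<bar> powr (p - 1)) * v $ i"
      unfolding g0 sgn[symmetric] by simp
    with der show ?thesis
      unfolding norm sqrt_powr[OF g_nonneg] by (rule DERIV_cong)
  qed
qed

text \<open>The terms linear in \<open>t\<close> cancel in \<open>y . y - (v . y)^2\<close>, leaving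
  \<open>t^2 (1 - v_i^2)\<close>, so only the linear part of the quadratic model contributes at
  \<open>t = 0\<close>.\<close>

lemma quad_partial_derivative:
  fixes v :: "real vec"
  assumes "v \<in> carrier_vec d" "scalar_prod v v = 1" "i < d"
  shows "((\<lambda>t. quad (L \<cdot>\<^sub>m (1\<^sub>m d - outer_prod v v)) (\<beta> \<cdot>\<^sub>v v) (\<rho> \<cdot>\<^sub>v v + t \<cdot>\<^sub>v unit_vec d i))
           has_real_derivative - \<beta> * v $ i) (at 0)"
proof -
  have "quad (L \<cdot>\<^sub>m (1\<^sub>m d - outer_prod v v)) (\<beta> \<cdot>\<^sub>v v) (\<rho> \<cdot>\<^sub>v v + t \<cdot>\<^sub>v unit_vec d i)
     = L / 2 * (\<rho>\<^sup>2 + 2 * \<rho> * t * v $ i + t\<^sup>2 - (\<rho> + t * v $ i)\<^sup>2) - \<beta> * (\<rho> + t * v $ i)" for t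
    using assms scalar_prods_on_line_perturbed[OF assms]
    by (subst quad_complement_projection) auto
  then show ?thesis
    by (simp only:) (auto intro!: derivative_eq_intros simp: algebra_simps)
qed

lemma gradient_quad_on_line:
  fixes v :: "real vec"
  assumes "v \<in> carrier_vec d" "scalar_prod v v = 1"
  shows "gradient d (quad (L \<cdot>\<^sub>m (1\<^sub>m d - outer_prod v v)) (\<beta> \<cdot>\<^sub>v v)) (\<rho> \<cdot>\<^sub>v v) = - \<beta> \<cdot>\<^sub>v v"
  using assms DERIV_imp_deriv[OF quad_partial_derivative[OF assms]]
  by (auto simp: gradient_def)

lemma gradient_objective_on_line:
  fixes v :: "real vec"
  assumes "p > 2" "v \<in> carrier_vec d" "scalar_prod v v = 1"
  shows "gradient d (objective (L \<cdot>\<^sub>m (1\<^sub>m d - outer_prod v v)) (\<beta> \<cdot>\<^sub>v v) s p) (\<rho> \<cdot>\<^sub>v v)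
     = (s * (sgn \<rho> * \<bar>\<rho>\<bar> powr (p - 1)) - \<beta>) \<cdot>\<^sub>v v"
proof -
  have "deriv (\<lambda>t. objective (L \<cdot>\<^sub>m (1\<^sub>m d - outer_prod v v)) (\<beta> \<cdot>\<^sub>v v) s p
          (\<rho> \<cdot>\<^sub>v v + t \<cdot>\<^sub>v unit_vec d i)) 0 = (s * (sgn \<rho> * \<bar>\<rho>\<bar> powr (p - 1)) - \<beta>) * v $ i"
    if "i < d" for i
    unfolding objective_def
    using DERIV_add[OF quad_partial_derivative[OF assms(2,3) that]
        DERIV_cmult[OF norm_powr_partial_derivative[OF assms that], of "s / p"]] assms(1)
    by (intro DERIV_imp_deriv) (auto simp: algebra_simps)
  then show ?thesis using assms by (auto simp: gradient_def)
qed

lemma objective_on_line: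
  fixes v :: "real vec"
  assumes "v \<in> carrier_vec d" "scalar_prod v v = 1"
  shows "objective (L \<cdot>\<^sub>m (1\<^sub>m d - outer_prod v v)) ((s * r powr (p - 1)) \<cdot>\<^sub>v v) s p (\<rho> \<cdot>\<^sub>v v)
     = s * (\<bar>\<rho>\<bar> powr p / p - r powr (p - 1) * \<rho>)"
proof -
  have "euclid_norm v = 1" using assms by (simp add: euclid_norm_def)
  then show ?thesis
    using assms by (simp add: objective_def quad_complement_projection[of _ d] euclid_norm_smult
        power2_eq_square algebra_simps)
qed

section \<open>The unique minimizer\<close>

lemma is_arg_min_unique:
  fixes f :: "'a \<Rightarrow> 'b::linorder"
  assumes "P x" "\<And>y. P y \<Longrightarrow> y \<noteq> x \<Longrightarrow> f x < f y"
  shows "is_arg_min f P y \<longleftrightarrow> y = x"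
  using assms unfolding is_arg_min_def by (metis order.asym)

lemma objective_gt_minimum:
  fixes v y :: "real vec"
  assumes "p > 2" "s > 0" "L > 0" "r > 0" "v \<in> carrier_vec d" "scalar_prod v v = 1"
    and y: "y \<in> carrier_vec d" "y \<noteq> r \<cdot>\<^sub>v v"
  defines "f \<equiv> objective (L \<cdot>\<^sub>m (1\<^sub>m d - outer_prod v v)) ((s * r powr (p - 1)) \<cdot>\<^sub>v v) s p"
  shows "f (r \<cdot>\<^sub>v v) < f y"
proof -
  let ?n = "euclid_norm y" and ?w = "scalar_prod v y"
  have n0: "?n \<ge> 0" by (simp add: euclid_norm_def scalar_prod_def sum_nonneg)
  have CS: "?w\<^sup>2 \<le> ?n\<^sup>2"
    using square_scalar_prod_unit_le[OF y(1) assms(5,6)] by (simp add: euclid_norm_square)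
  then have wn: "?w \<le> ?n" using n0 power2_le_imp_le by blast
  have fy: "f y = L / 2 * (?n\<^sup>2 - ?w\<^sup>2) + s * (?n powr p / p - r powr (p - 1) * ?w)"
    using assms by (simp add: f_def objective_def quad_complement_projection[of _ d] euclid_norm_square
        algebra_simps)
  have fx: "f (r \<cdot>\<^sub>v v) = s * (r powr p / p - r powr p)"
    unfolding f_def objective_on_line[OF assms(5,6)]
    using powr_mult_self_pred[of r p] assms(4) by (simp add: mult.commute)
  have ge: "f y \<ge> s * (?n powr p / p - r powr (p - 1) * ?w)"
    using fy CS assms by simp
  show ?thesis
  proof (cases "?n = r")
    case True
    have "scalar_prod (y - r \<cdot>\<^sub>v v) (y - r \<cdot>\<^sub>v v) \<noteq> 0"
    proof
      assume "scalar_prod (y - r \<cdot>\<^sub>v v) (y - r \<cdot>\<^sub>v v) = 0"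
      then have 0: "y - r \<cdot>\<^sub>v v = 0\<^sub>v d"
        using assms by (intro scalar_prod_self_eq_0) auto
      have "y = r \<cdot>\<^sub>v v"
      proof (rule eq_vecI)
        fix i assume "i < dim_vec (r \<cdot>\<^sub>v v)"
        then show "y $ i = (r \<cdot>\<^sub>v v) $ i"
          using arg_cong[OF 0, of "\<lambda>z. z $ i"] assms(5) y(1) by simp
      qed (use assms(5) y(1) in auto)
      then show False using y(2) by simp
    qed
    \<comment> \<open>On the sphere of radius \<open>r\<close> the squared distance to the minimizer
      is a multiple of \<open>r - w\<close>, so \<open>w = r\<close> would force \<open>y\<close> to
      be the minimizer.\<close>
    moreover have "scalar_prod (y - r \<cdot>\<^sub>v v) (y - r \<cdot>\<^sub>v v) = 2 * r * (r - ?w)"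
      using scalar_prod_diff_smult_unit[OF y(1) assms(5,6)] euclid_norm_square[of y] True
      by (simp add: power2_eq_square algebra_simps)
    ultimately have "?w \<noteq> r" by auto
    then have "?w < r" using wn True by simp
    then have "r powr (p - 1) * ?w < r powr (p - 1) * r" using assms(4) by simp
    also have "\<dots> = r powr p" using powr_mult_self_pred[of r p] assms(4) by (simp add: mult.commute)
    finally have "s * (r powr p / p - r powr p) < s * (r powr p / p - r powr (p - 1) * ?w)"
      using assms(2) by simp
    then show ?thesis using ge fx True by simp
  next
    case False
    have "r powr p / p - r powr p < ?n powr p / p - r powr (p - 1) * ?n"
      using power_young_strict[of p r ?n] assms False n0 by simp
    also have "\<dots> \<le> ?n powr p / p - r powr (p - 1) * ?w"
      using wn assms(4) by simp
    finally have "s * (r powr p / p - r powr p) < s * (?n powr p / p - r powr (p - 1) * ?w)"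
      using assms(2) by simp
    then show ?thesis using ge fx by simp
  qed
qed

section \<open>Iterates stay on the line\<close>

text \<open>The gradient of the quadratic part is the constant vector \<open>- \<gamma> v\<close> on
  the line, so every step adds multiples of \<open>v\<close>. Thus the scalars that represent the
  iterates always exist, and statements about all such scalars are not vacuous.\<close>

lemma one_step_method_on_line:
  fixes v :: "real vec"
  assumes "v \<in> carrier_vec d" "scalar_prod v v = 1"
    and "one_step_method d (L \<cdot>\<^sub>m (1\<^sub>m d - outer_prod v v)) (\<gamma> \<cdot>\<^sub>v v) \<alpha> \<beta> x"
  shows "\<exists>\<rho>. \<forall>k. x k = \<rho> k \<cdot>\<^sub>v v"
proof -
  have "\<exists>a. x k = a \<cdot>\<^sub>v v" for k
  proof (induction k)
    case 0
    have "x 0 = 0 \<cdot>\<^sub>v v" using assms by (auto simp: one_step_method_def)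
    then show ?case by blast
  next
    case (Suc k)
    then obtain a where "x k = a \<cdot>\<^sub>v v" by blast
    then have "x (Suc k) = \<alpha> k \<cdot>\<^sub>v (a \<cdot>\<^sub>v v) - \<beta> k \<cdot>\<^sub>v (- \<gamma> \<cdot>\<^sub>v v)"
      using assms(3) gradient_quad_on_line[OF assms(1,2)] by (simp add: one_step_method_def)
    also have "\<dots> = (\<alpha> k * a + \<beta> k * \<gamma>) \<cdot>\<^sub>v v"
      by (auto simp: algebra_simps)
    finally show ?case by blast
  qed
  then show ?thesis by metis
qed

section \<open>Gradient gap and scaling of the radius\<close>

text \<open>The signed power is increasing, so its value at \<open>y\<close> is at most its value at
  \<open>r / 2\<close>; for \<open>y \<le> 0\<close> it is nonpositive.\<close>

lemma power_slope_gap_lower_bound: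
  fixes p r y :: real
  assumes "p > 1" "r > 0" "y \<le> r / 2"
  shows "r powr (p - 1) - sgn y * \<bar>y\<bar> powr (p - 1) \<ge> (1 - (1/2) powr (p - 1)) * r powr (p - 1)"
proof -
  have "sgn y * \<bar>y\<bar> powr (p - 1) \<le> (r / 2) powr (p - 1)"
  proof (cases "y > 0")
    case True
    then show ?thesis using assms by (simp add: powr_mono2)
  next
    case False
    then have "sgn y * \<bar>y\<bar> powr (p - 1) \<le> 0"
      by (intro mult_nonpos_nonneg) (auto simp: sgn_if)
    then show ?thesis by (meson order.trans powr_ge_zero)
  qed
  also have "\<dots> = (1/2) powr (p - 1) * r powr (p - 1)"
    using assms by (simp add: powr_divide)
  finally show ?thesis by (simp add: algebra_simps)
qed

text \<open>One identity for both rates: \<open>e = 2\<close>, \<open>q = p\<close> for the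
  objective and \<open>e = 1\<close>, \<open>q = p - 1\<close> for the gradient. In both cases
  \<open>q - e = p - 2\<close>, so the radius is the same. The power of \<open>s\<close> works out
  because \<open>\<theta> = 1 + e / (q - e)\<close>.\<close>

lemma scale_root_powr:
  fixes s L M N q e :: real
  assumes "s > 0" "L > 0" "M > 0" "N > 0" "q > e" "q > 0"
  shows "s * ((L / (M * s * N)) powr (1 / (q - e))) powr q
       = (1 / M) powr (q / (q - e)) * (L / (s powr (e / q) * N)) powr (q / (q - e))"
proof -
  define \<theta> where "\<theta> = q / (q - e)"
  have "1 + e / (q - e) = \<theta>" using assms by (simp add: \<theta>_def field_simps)
  then have s: "s powr \<theta> = s * s powr (e / (q - e))"
    using assms by (simp add: powr_add[symmetric] powr_mult_base)
  have "s * ((L / (M * s * N)) powr (1 / (q - e))) powr q = s * (L / (M * s * N)) powr \<theta>"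
    by (simp add: powr_powr \<theta>_def)
  also have "\<dots> = s * (L powr \<theta> / (M powr \<theta> * s powr \<theta> * N powr \<theta>))"
    using assms by (simp add: powr_divide powr_mult)
  also have "\<dots> = L powr \<theta> / (M powr \<theta> * s powr (e / (q - e)) * N powr \<theta>)"
    unfolding s using assms by simp
  also have "\<dots> = (1 / M) powr \<theta> * (L / (s powr (e / q) * N)) powr \<theta>"
    using assms by (simp add: powr_divide powr_mult powr_powr \<theta>_def)
  finally show ?thesis by (simp add: \<theta>_def)
qed

section \<open>Choice of the constants and the radius, and the two rates\<close>

theorem theorem12:
  fixes p :: real
  assumes "p > 2"
  shows "\<exists>c>0. \<forall>(s::real) (L::real) (N::nat) (d::nat) (v::real vec).
    s > 0 \<longrightarrow> L > 0 \<longrightarrow> N \<ge> 1 \<longrightarrow> v \<in> carrier_vec d \<longrightarrow> euclid_norm v = 1 \<longrightarrow>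
    (\<exists>r>0.
      let A = L \<cdot>\<^sub>m (1\<^sub>m d - outer_prod v v);
          b = (s * r powr (p - 1)) \<cdot>\<^sub>v v;
          f = objective A b s p;
          xopt = r \<cdot>\<^sub>v v;
          Q = (L + s * (p - 1) * r powr (p - 2)) / (s * (p - 1) * r powr (p - 2))
      in (\<forall>y. is_arg_min f (\<lambda>z. z \<in> carrier_vec d) y \<longleftrightarrow> y = xopt) \<and>
         (\<forall>\<alpha> \<beta> x. one_step_method d A b \<alpha> \<beta> x \<longrightarrow>
            (\<exists>\<rho>. \<forall>k. x k = \<rho> k \<cdot>\<^sub>v v) \<and>
            (\<forall>\<rho>. (\<forall>k. x k = \<rho> k \<cdot>\<^sub>v v) \<longrightarrow>
                 (\<forall>k. \<rho> k \<le> r \<and> r - \<rho> (Suc k) \<ge> (r - \<rho> k) * (1 - inverse Q)) \<longrightarrow>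
                 f (x N) - f xopt \<ge> c * (L / (s powr (2 / p) * real N)) powr (p / (p - 2)) \<and>
                 euclid_norm (gradient d f (x N))
                   \<ge> c * (L / (s powr (1 / (p - 1)) * real N)) powr ((p - 1) / (p - 2)))))"
proof -
  \<comment> \<open>All constants depend on \<open>p\<close> alone. \<open>\<kappa>\<close> and
    \<open>\<mu>\<close> are the factors from the objective and slope gaps, the powers of
    \<open>1 / M\<close> come from inserting the radius, and the minimum serves both bounds.\<close>
  define M where "M = 2 * (p - 1)"
  define \<kappa> where "\<kappa> = (1/2) powr p / p + 1/2 - 1/p"
  define \<mu> where "\<mu> = 1 - (1/2 :: real) powr (p - 1)"
  define c where "c = min (\<kappa> * (1 / M) powr (p / (p - 2))) (\<mu> * (1 / M) powr ((p - 1) / (p - 2)))"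
  have M: "M > 0" using assms by (simp add: M_def)
  \<comment> \<open>\<open>\<kappa>\<close> is the strictly positive gap at \<open>y = 1/2\<close>
    for \<open>r = 1\<close>.\<close>
  have \<kappa>: "\<kappa> > 0" using power_young_strict[of p 1 "1/2"] assms by (simp add: \<kappa>_def)
  have \<mu>: "\<mu> > 0" using powr_less_mono2[of "p - 1" "1/2" 1] assms by (simp add: \<mu>_def)
  show ?thesis
  proof (rule exI[of _ c], intro conjI allI impI)
    show "c > 0" using M \<kappa> \<mu> by (simp add: c_def)
  next
    fix s L :: real and N d :: nat and v :: "real vec"
    assume s: "s > 0" and L: "L > 0" and N: "N \<ge> 1"
      and v: "v \<in> carrier_vec d" and nv: "euclid_norm v = 1"
    have vv: "scalar_prod v v = 1" using nv euclid_norm_square[of v] by simp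
    define r where "r = (L / (M * s * real N)) powr (1 / (p - 2))"
    have r: "r > 0" using s L N M by (simp add: r_def)
    \<comment> \<open>The second derivative of the objective along \<open>v\<close> at the
      minimizer.\<close>
    define m where "m = s * (p - 1) * r powr (p - 2)"
    have "r powr (p - 2) = L / (M * s * real N)"
      using assms s L N M by (simp add: r_def powr_powr)
    then have m: "m = L / (2 * real N)"
      using assms s by (simp add: m_def M_def del: right_diff_distrib_numeral)
    define Q where "Q = (L + m) / m"
    have "Q = 2 * real N + 1"
      using L N by (simp add: Q_def m add_divide_distrib distrib_right)
    then have Q: "inverse Q = 1 / (2 * real N + 1)"
      by (simp add: inverse_eq_divide)
    define A where "A = L \<cdot>\<^sub>m (1\<^sub>m d - outer_prod v v)"
    define b where "b = (s * r powr (p - 1)) \<cdot>\<^sub>v v"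
    define f where "f = objective A b s p"
    have f_line: "f (\<rho> \<cdot>\<^sub>v v) = s * (\<bar>\<rho>\<bar> powr p / p - r powr (p - 1) * \<rho>)" for \<rho>
      unfolding f_def A_def b_def by (rule objective_on_line[OF v vv])
    have min: "is_arg_min f (\<lambda>z. z \<in> carrier_vec d) y \<longleftrightarrow> y = r \<cdot>\<^sub>v v" for y
      unfolding f_def A_def b_def
      using objective_gt_minimum[OF assms s L r v vv] v by (intro is_arg_min_unique) auto
    have bounds: "f (x N) - f (r \<cdot>\<^sub>v v) \<ge> c * (L / (s powr (2 / p) * real N)) powr (p / (p - 2)) \<and>
           euclid_norm (gradient d f (x N))
             \<ge> c * (L / (s powr (1 / (p - 1)) * real N)) powr ((p - 1) / (p - 2))"
      if osm: "one_step_method d A b \<alpha> \<beta> x" and line: "\<forall>k. x k = \<rho> k \<cdot>\<^sub>v v"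
        and step: "\<forall>k. \<rho> k \<le> r \<and> r - \<rho> (Suc k) \<ge> (r - \<rho> k) * (1 - inverse Q)" for \<alpha> \<beta> x \<rho>
    proof
      \<comment> \<open>Only the vector \<open>x 0\<close> is known to vanish; pairing with the unit
        vector \<open>v\<close> recovers the scalar.\<close>
      have "\<rho> 0 \<cdot>\<^sub>v v = 0\<^sub>v d" using osm line by (simp add: one_step_method_def)
      then have "scalar_prod v (\<rho> 0 \<cdot>\<^sub>v v) = 0" using v by simp
      then have "\<rho> 0 = 0" using v vv by simp
      then have "r - \<rho> N \<ge> r * (1 - real N * inverse Q)"
        using step r unfolding Q by (intro geometric_gap) auto
      \<comment> \<open>This is \<open>N / (2 N + 1) \<le> 1/2\<close>, which keeps the iterate in
        the half-line \<open>\<rho> \<le> r / 2\<close> of the gap bounds.\<close>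
      moreover have "real N * inverse Q \<le> 1/2"
        unfolding Q by (simp add: field_simps)
      then have "r * (1 - real N * inverse Q) \<ge> r * (1/2)"
        using r by (intro mult_left_mono) auto
      ultimately have half: "\<rho> N \<le> r / 2" by simp
      have "c * (L / (s powr (2 / p) * real N)) powr (p / (p - 2))
          \<le> \<kappa> * (1 / M) powr (p / (p - 2)) * (L / (s powr (2 / p) * real N)) powr (p / (p - 2))"
        by (intro mult_right_mono) (auto simp: c_def)
      also have "\<dots> = \<kappa> * (s * r powr p)"
        using scale_root_powr[of s L M "real N" 2 p] s L M N assms by (simp add: r_def)
      also have "\<dots> = s * (\<kappa> * r powr p)" by simp
      also have "\<dots> \<le> s * ((\<bar>\<rho> N\<bar> powr p / p - r powr (p - 1) * \<rho> N) - (r powr p / p - r powr p))"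
        unfolding \<kappa>_def using power_gap_lower_bound[OF _ r half, of p] assms s
        by (intro mult_left_mono) auto
      also have "\<dots> = f (x N) - f (r \<cdot>\<^sub>v v)"
        using line r powr_mult_self_pred[OF r, of p] by (simp add: f_line algebra_simps)
      finally show "f (x N) - f (r \<cdot>\<^sub>v v) \<ge> c * (L / (s powr (2 / p) * real N)) powr (p / (p - 2))" .
      let ?G = "sgn (\<rho> N) * \<bar>\<rho> N\<bar> powr (p - 1)"
      have "c * (L / (s powr (1 / (p - 1)) * real N)) powr ((p - 1) / (p - 2))
          \<le> \<mu> * (1 / M) powr ((p - 1) / (p - 2)) * (L / (s powr (1 / (p - 1)) * real N)) powr ((p - 1) / (p - 2))"
        by (intro mult_right_mono) (auto simp: c_def)
      also have "\<dots> = \<mu> * (s * r powr (p - 1))"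
        using scale_root_powr[of s L M "real N" 1 "p - 1"] s L M N assms by (simp add: r_def)
      also have "\<dots> = s * (\<mu> * r powr (p - 1))" by simp
      also have "\<dots> \<le> s * (r powr (p - 1) - ?G)"
        unfolding \<mu>_def using power_slope_gap_lower_bound[OF _ r half, of p] assms s
        by (intro mult_left_mono) auto
      \<comment> \<open>The gradient is a multiple of the unit vector \<open>v\<close>, so its norm
        is the modulus of this coefficient.\<close>
      also have "\<dots> \<le> \<bar>s * ?G - s * r powr (p - 1)\<bar>"
        by (simp add: right_diff_distrib)
      also have "\<dots> = euclid_norm (gradient d f (x N))"
        using line nv gradient_objective_on_line[OF assms v vv]
        by (simp add: f_def A_def b_def euclid_norm_smult)
      finally show "euclid_norm (gradient d f (x N))
          \<ge> c * (L / (s powr (1 / (p - 1)) * real N)) powr ((p - 1) / (p - 2))" .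
    qed
    have line: "\<exists>\<rho>. \<forall>k. x k = \<rho> k \<cdot>\<^sub>v v" if "one_step_method d A b \<alpha> \<beta> x" for \<alpha> \<beta> x
      using one_step_method_on_line[OF v vv] that unfolding A_def b_def by blast
    show "\<exists>r>0.
      let A = L \<cdot>\<^sub>m (1\<^sub>m d - outer_prod v v);
          b = (s * r powr (p - 1)) \<cdot>\<^sub>v v;
          f = objective A b s p;
          xopt = r \<cdot>\<^sub>v v;
          Q = (L + s * (p - 1) * r powr (p - 2)) / (s * (p - 1) * r powr (p - 2))
      in (\<forall>y. is_arg_min f (\<lambda>z. z \<in> carrier_vec d) y \<longleftrightarrow> y = xopt) \<and>
         (\<forall>\<alpha> \<beta> x. one_step_method d A b \<alpha> \<beta> x \<longrightarrow>
            (\<exists>\<rho>. \<forall>k. x k = \<rho> k \<cdot>\<^sub>v v) \<and>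
            (\<forall>\<rho>. (\<forall>k. x k = \<rho> k \<cdot>\<^sub>v v) \<longrightarrow>
                 (\<forall>k. \<rho> k \<le> r \<and> r - \<rho> (Suc k) \<ge> (r - \<rho> k) * (1 - inverse Q)) \<longrightarrow>
                 f (x N) - f xopt \<ge> c * (L / (s powr (2 / p) * real N)) powr (p / (p - 2)) \<and>
                 euclid_norm (gradient d f (x N))
                   \<ge> c * (L / (s powr (1 / (p - 1)) * real N)) powr ((p - 1) / (p - 2))))"
      using r min bounds line
      unfolding Let_def f_def A_def b_def Q_def m_def by (intro exI[of _ r]) blast
  qed
qed

end
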